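(* Let $k$ be a field, $n,q$ integers with $q\geq 2$, and let $I\subset k[x_1,\ldots,x_n]$ be the initial squarefree lexsegment ideal generated in degree $q$ determined by the monomial $v=x_{j_1}\cdots x_{j_q}$, with $2\leq j_1<\cdots<j_q\leq n$. For $1\leq t\leq q$ let $A_t=[j_t]\setminus\{j_1,\ldots,j_{t-1}\}$. Then $I$ has the minimal primary decomposition $$I=\left(\bigcap_{t=1}^{q}(x_i : i\in A_t)\right)\cap\left(\bigcap_{F}P_{F^c}\right),$$ where the second intersection is over all $F\subset[n]$ with $|F|=q-1$ and $F\cap A_t\neq\emptyset$ for all $1\le t\le q$.
   Context: Monomials are ordered by the lexicographic order with $x_1>x_2>\cdots>x_n$. $\mathrm{Mon}^s_q(S)$ is the set of squarefree monomials of degree $q$ in $S=k[x_1,\ldots,x_n]$. For $v\in \mathrm{Mon}^s_q(S)$ put $L^i(v)=\{w\in\mathrm{Mon}^s_q(S): w\geq_{lex}v\}$; the initial squarefree lexsegment ideal generated in degree $q$ determined by $v$ is the ideal $(L^i(v))$. $[m]=\{1,\ldots,m\}$. For $G\subset[n]$, $P_G=(x_i: i\in G)$ and $G^c=[n]\setminus G$. "Minimal primary decomposition" means an irredundant primary decomposition: the listed ideals are exactly the distinct minimal primes of $I$. *)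

theory Defs
  imports "HOL-Algebra.Ideal" "HOL-Library.Poly_Mapping"
begin

section \<open>Primary decompositions\<close>

definition primary_ideal :: "'a set \<Rightarrow> ('a, 'b) ring_scheme \<Rightarrow> bool" where
  "primary_ideal Q R \<longleftrightarrow>
     ideal Q R \<and> Q \<noteq> carrier R \<and>
     (\<forall>a\<in>carrier R. \<forall>b\<in>carrier R.
        a \<otimes>\<^bsub>R\<^esub> b \<in> Q \<longrightarrow> a \<in> Q \<or> (\<exists>m::nat. m > 0 \<and> b [^]\<^bsub>R\<^esub> m \<in> Q))"

definition radical :: "('a, 'b) ring_scheme \<Rightarrow> 'a set \<Rightarrow> 'a set" where
  "radical R I = {a \<in> carrier R. \<exists>m::nat. m > 0 \<and> a [^]\<^bsub>R\<^esub> m \<in> I}"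

definition minimal_primes :: "('a, 'b) ring_scheme \<Rightarrow> 'a set \<Rightarrow> 'a set set" where
  "minimal_primes R I =
     {P. primeideal P R \<and> I \<subseteq> P \<and>
         (\<forall>P'. primeideal P' R \<and> I \<subseteq> P' \<and> P' \<subseteq> P \<longrightarrow> P' = P)}"

text \<open>
  Intersections are taken inside the carrier, so that the empty intersection is the unit ideal.
  The components form an indexed family, so a repeated component counts as redundant.
\<close>

definition minimal_primary_decomposition ::
    "('a, 'b) ring_scheme \<Rightarrow> 'a set \<Rightarrow> 'i set \<Rightarrow> ('i \<Rightarrow> 'a set) \<Rightarrow> bool" where
  "minimal_primary_decomposition R I \<Lambda> Q \<longleftrightarrow>
     finite \<Lambda> \<and>
     (\<forall>i\<in>\<Lambda>. primary_ideal (Q i) R) \<and>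
     I = carrier R \<inter> (\<Inter>i\<in>\<Lambda>. Q i) \<and>
     (\<forall>i\<in>\<Lambda>. \<not> carrier R \<inter> (\<Inter>l\<in>\<Lambda> - {i}. Q l) \<subseteq> Q i) \<and>
     inj_on (\<lambda>i. radical R (Q i)) \<Lambda>"


section \<open>The polynomial ring in the variables indexed by 1, ..., n\<close>

text \<open>
  A monomial is represented by its exponent vector \<open>nat \<Rightarrow>\<^sub>0 nat\<close>, and a polynomial by its
  finitely supported coefficient function on monomials. Multiplication on the latter type is
  convolution.
\<close>

type_synonym 'k mpoly = "(nat \<Rightarrow>\<^sub>0 nat) \<Rightarrow>\<^sub>0 'k"

definition mpoly_ring :: "nat \<Rightarrow> 'k::comm_ring_1 mpoly ring" where
  "mpoly_ring n =
     \<lparr>carrier = {p. \<forall>m\<in>Poly_Mapping.keys p. Poly_Mapping.keys m \<subseteq> {1..n}},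
      monoid.mult = (*), one = 1, zero = 0, add = (+)\<rparr>"

definition monomial :: "(nat \<Rightarrow>\<^sub>0 nat) \<Rightarrow> 'k::comm_ring_1 mpoly" where
  "monomial m = Poly_Mapping.single m 1"

definition var :: "nat \<Rightarrow> 'k::comm_ring_1 mpoly" where
  "var i = monomial (Poly_Mapping.single i 1)"

definition var_ideal :: "nat \<Rightarrow> nat set \<Rightarrow> 'k::comm_ring_1 mpoly set" where
  "var_ideal n G = Idl\<^bsub>mpoly_ring n\<^esub> (var ` G)"

lemma cring_mpoly_ring: "cring (mpoly_ring n :: 'k::comm_ring_1 mpoly ring)"
proof (rule cringI)
  have ops: "x \<oplus>\<^bsub>mpoly_ring n\<^esub> y = x + y" "x \<otimes>\<^bsub>mpoly_ring n\<^esub> y = x * y"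
    "\<zero>\<^bsub>mpoly_ring n\<^esub> = 0" "\<one>\<^bsub>mpoly_ring n\<^esub> = 1" for x y :: "'k mpoly"
    by (simp_all add: mpoly_ring_def)
  have units: "0 \<in> carrier (mpoly_ring n :: 'k mpoly ring)"
    "1 \<in> carrier (mpoly_ring n :: 'k mpoly ring)"
    by (simp_all add: mpoly_ring_def)
  have add: "p + r \<in> carrier (mpoly_ring n)"
    if "p \<in> carrier (mpoly_ring n)" "r \<in> carrier (mpoly_ring n)" for p r :: "'k mpoly"
    using that Poly_Mapping.keys_add[of p r] unfolding mpoly_ring_def by auto
  have mult: "p * r \<in> carrier (mpoly_ring n)"
    if p: "p \<in> carrier (mpoly_ring n)" and r: "r \<in> carrier (mpoly_ring n)" for p r :: "'k mpoly"
  proof -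
    have "Poly_Mapping.keys m \<subseteq> {1..n}" if m: "m \<in> Poly_Mapping.keys (p * r)" for m
    proof -
      obtain a b where "m = a + b" "a \<in> Poly_Mapping.keys p" "b \<in> Poly_Mapping.keys r"
        using m keys_mult[of p r] by auto
      with p r Poly_Mapping.keys_add[of a b] show ?thesis
        unfolding mpoly_ring_def by fastforce
    qed
    then show ?thesis by (simp add: mpoly_ring_def)
  qed
  have uminus: "- p \<in> carrier (mpoly_ring n)" if "p \<in> carrier (mpoly_ring n)" for p :: "'k mpoly"
    using that unfolding mpoly_ring_def by simp
  show "abelian_group (mpoly_ring n :: 'k mpoly ring)"
  proof (rule abelian_groupI)
    fix p :: "'k mpoly"
    assume "p \<in> carrier (mpoly_ring n)"
    then show "\<exists>r\<in>carrier (mpoly_ring n). r \<oplus>\<^bsub>mpoly_ring n\<^esub> p = \<zero>\<^bsub>mpoly_ring n\<^esub>"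
      by (intro bexI[of _ "- p"] uminus) (simp add: ops)
  qed (simp_all only: ops add units ac_simps add_0_left add_0_right)
  show "comm_monoid (mpoly_ring n :: 'k mpoly ring)"
    by (rule comm_monoidI) (simp_all only: ops mult units ac_simps mult_1_left mult_1_right)
qed (simp add: mpoly_ring_def distrib_right)


section \<open>Initial squarefree lexsegment ideals\<close>

definition squarefree_monomials :: "nat \<Rightarrow> nat \<Rightarrow> (nat \<Rightarrow>\<^sub>0 nat) set" where
  "squarefree_monomials n q =
     {m. Poly_Mapping.keys m \<subseteq> {1..n} \<and>
         (\<forall>i. Poly_Mapping.lookup m i \<le> 1) \<and>
         (\<Sum>i\<in>Poly_Mapping.keys m. Poly_Mapping.lookup m i) = q}"

text \<open>
  The library order on \<open>nat \<Rightarrow>\<^sub>0 nat\<close> compares exponents at the first index where they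
  differ, and hence is the lexicographic order with $x_1 > x_2 > \cdots$:
\<close>

lemma less_monomial_iff:
  fixes v w :: "nat \<Rightarrow>\<^sub>0 nat"
  shows "v < w \<longleftrightarrow>
    (\<exists>i. Poly_Mapping.lookup v i < Poly_Mapping.lookup w i \<and>
         (\<forall>l<i. Poly_Mapping.lookup v l = Poly_Mapping.lookup w l))"
  by (simp add: less_poly_mapping.rep_eq less_fun_def)

definition initial_lexsegment :: "nat \<Rightarrow> nat \<Rightarrow> (nat \<Rightarrow>\<^sub>0 nat) \<Rightarrow> (nat \<Rightarrow>\<^sub>0 nat) set" where
  "initial_lexsegment n q v = {w \<in> squarefree_monomials n q. w \<ge> v}"

definition initial_lexsegment_ideal ::
    "nat \<Rightarrow> nat \<Rightarrow> (nat \<Rightarrow>\<^sub>0 nat) \<Rightarrow> 'k::comm_ring_1 mpoly set" where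
  "initial_lexsegment_ideal n q v = Idl\<^bsub>mpoly_ring n\<^esub> (monomial ` initial_lexsegment n q v)"

end

theory Submission
  imports Defs
begin

text \<open>
  A polynomial lies in a monomial ideal iff each of its monomials is divisible by a generator, and
  it lies in \<open>P\<^sub>G = (x\<^sub>i : i \<in> G)\<close> iff the support of each of its monomials meets \<open>G\<close>
  (\<open>monomial_ideal_mem_iff\<close>, \<open>var_ideal_mem_iff\<close>). So the equality of ideals is a statement about
  the support \<open>H \<subseteq> [n]\<close> of a single monomial: \<open>H\<close> contains a \<open>q\<close>-set \<open>W\<close> that is lexicographically
  at least \<open>V = {j\<^sub>1, \<dots>, j\<^sub>q}\<close> iff \<open>H\<close> meets every \<open>A\<^sub>t\<close> and every complement \<open>F\<^sup>c\<close>.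

  The point is that \<open>A\<^sub>t\<close> detects the lexicographic order. If \<open>W\<close> misses \<open>A\<^sub>t\<close>, then inside \<open>[j\<^sub>t]\<close>
  it has only elements of \<open>V\<close> and lacks \<open>j\<^sub>t\<close>, so it is smaller than \<open>V\<close>. Conversely, if
  \<open>|H| \<ge> q\<close>, \<open>V\<close> is not contained in \<open>H\<close>, and \<open>j\<^sub>s\<close> is the first element of \<open>V\<close> missing from \<open>H\<close>,
  then an element of \<open>H \<inter> A\<^sub>s\<close> lies below \<open>j\<^sub>s\<close> and outside \<open>V\<close>; any
  \<open>q\<close>-subset of \<open>H\<close> containing it and \<open>j\<^sub>1, \<dots>, j\<^sub>s\<^sub>-\<^sub>1\<close> is larger than \<open>V\<close>. The sets \<open>F\<^sup>c\<close> only
  enforce \<open>|H| \<ge> q\<close>: a smaller \<open>H\<close> that meets all \<open>A\<^sub>t\<close> extends to some \<open>F\<close>, whose complement it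
  misses. This is \<open>contains_lex_ge_iff\<close>.

  The ideals \<open>P\<^sub>G\<close> are prime, and the sets \<open>A\<^sub>t\<close>, \<open>F\<^sup>c\<close> form an antichain (\<open>cover_antichain\<close>).
  In any commutative ring, an ideal that is the intersection of a finite antichain of primes has
  these primes as its minimal primes, and they form an irredundant primary decomposition, because a
  prime containing a finite intersection of ideals contains one of them
  (\<open>antichain_of_primes_decomposition\<close>).
\<close>

section \<open>Intersections of finitely many prime ideals\<close>

text \<open>
  If no \<open>Q\<^sub>i\<close> were contained in \<open>P\<close>, a product of elements \<open>a\<^sub>i \<in> Q\<^sub>i\<close> outside \<open>P\<close> would lie in
  the intersection but not in \<open>P\<close>. The induction multiplies one factor at a time. Intersecting with
  the carrier makes the empty family a legitimate base case: no prime contains the unit ideal.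
\<close>

lemma (in cring) primeideal_contains_Inter:
  assumes P: "primeideal P R" and fin: "finite \<Lambda>"
    and Q: "\<And>i. i \<in> \<Lambda> \<Longrightarrow> ideal (Q i) R"
    and sub: "carrier R \<inter> (\<Inter>i\<in>\<Lambda>. Q i) \<subseteq> P"
  shows "\<exists>i\<in>\<Lambda>. Q i \<subseteq> P"
  using fin Q sub
proof (induction \<Lambda>)
  case empty
  interpret primeideal P R by (fact P)
  show ?case using empty I_notcarr a_subset by auto
next
  case (insert x \<Lambda>)
  interpret P: primeideal P R by (fact P)
  show ?case
  proof (cases "Q x \<subseteq> P")
    case False
    then obtain a where a: "a \<in> Q x" "a \<notin> P" by blast
    interpret Qx: ideal "Q x" R by (rule insert.prems) simp
    have "carrier R \<inter> (\<Inter>i\<in>\<Lambda>. Q i) \<subseteq> P"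
    proof
      fix b assume b: "b \<in> carrier R \<inter> (\<Inter>i\<in>\<Lambda>. Q i)"
      have "a \<otimes> b \<in> Q i" if "i \<in> insert x \<Lambda>" for i
        using that a b Qx.I_r_closed[of a b] Qx.Icarr[of a]
          ideal.I_l_closed[OF insert.prems(1)[OF that], of b a] by auto
      then have "a \<otimes> b \<in> P" using insert.prems(2) a b Qx.Icarr[of a] by auto
      then show "b \<in> P" using P.I_prime[of a b] a b Qx.Icarr[of a] by auto
    qed
    then show ?thesis using insert by auto
  qed simp
qed

lemma (in primeideal) pow_mem_iff:
  fixes m :: nat
  assumes "a \<in> carrier R" "m > 0"
  shows "a [^] m \<in> I \<longleftrightarrow> a \<in> I"
  using assms(2)
proof (induction m)
  case (Suc m)
  show ?case
  proof (cases "m = 0")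
    case True
    then show ?thesis using assms(1) by simp
  next
    case False
    then show ?thesis
      using Suc assms(1) I_prime[of "a [^] m" a] I_l_closed[of a "a [^] m"] by auto
  qed
qed simp

lemma (in primeideal) radical_eq: "radical R I = I"
proof (intro equalityI subsetI)
  fix a assume "a \<in> I"
  then have "a \<in> carrier R" "a [^] (1::nat) \<in> I" using Icarr by simp_all
  then show "a \<in> radical R I" unfolding radical_def using zero_less_one by blast
qed (use pow_mem_iff in \<open>auto simp: radical_def\<close>)

lemma (in primeideal) primary_ideal: "primary_ideal I R"
  unfolding primary_ideal_def
proof (intro conjI ballI impI)
  show "ideal I R" by (rule is_ideal)
  show "I \<noteq> carrier R" using I_notcarr by simp
  fix a b assume "a \<in> carrier R" "b \<in> carrier R" "a \<otimes> b \<in> I"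
  then have "a \<in> I \<or> b [^] (1::nat) \<in> I" using I_prime by simp
  then show "a \<in> I \<or> (\<exists>m::nat. m > 0 \<and> b [^] m \<in> I)" by (meson zero_less_one)
qed

text \<open>
  A prime above \<open>I\<close> contains some \<open>Q\<^sub>l\<close>. For the primes \<open>Q\<^sub>i\<close> themselves the antichain condition
  forces \<open>l = i\<close>, which gives both minimality of \<open>Q\<^sub>i\<close> and irredundance; radicals are distinct
  because primes are radical.
\<close>

lemma (in cring) antichain_of_primes_decomposition:
  assumes fin: "finite \<Lambda>"
    and prime: "\<And>i. i \<in> \<Lambda> \<Longrightarrow> primeideal (Q i) R"
    and anti: "\<And>i l. i \<in> \<Lambda> \<Longrightarrow> l \<in> \<Lambda> \<Longrightarrow> Q i \<subseteq> Q l \<Longrightarrow> i = l"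
    and I: "I = carrier R \<inter> (\<Inter>i\<in>\<Lambda>. Q i)"
  shows "minimal_primary_decomposition R I \<Lambda> Q"
    and "bij_betw Q \<Lambda> (minimal_primes R I)"
proof -
  have ideal: "ideal (Q i) R" if "i \<in> \<Lambda>" for i
    using prime[OF that] by (rule primeideal.axioms(1))
  have irredundant: "\<not> carrier R \<inter> (\<Inter>l\<in>\<Lambda> - {i}. Q l) \<subseteq> Q i" if "i \<in> \<Lambda>" for i
  proof
    assume "carrier R \<inter> (\<Inter>l\<in>\<Lambda> - {i}. Q l) \<subseteq> Q i"
    from primeideal_contains_Inter[OF prime[OF that] _ _ this] fin ideal
    obtain l where "l \<in> \<Lambda> - {i}" "Q l \<subseteq> Q i" by auto
    then show False using anti[of l i] that by auto
  qed
  have inj: "inj_on Q \<Lambda>"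
    using anti by (auto simp: inj_on_def)
  then have "inj_on (\<lambda>i. radical R (Q i)) \<Lambda>"
    by (simp add: inj_on_def primeideal.radical_eq[OF prime])
  then show "minimal_primary_decomposition R I \<Lambda> Q"
    using fin irredundant I primeideal.primary_ideal[OF prime]
    by (auto simp: minimal_primary_decomposition_def)
  have above: "\<exists>l\<in>\<Lambda>. Q l \<subseteq> P" if "primeideal P R" "I \<subseteq> P" for P
    using that(2) unfolding I by (intro primeideal_contains_Inter[OF that(1) fin ideal])
  have I_le: "I \<subseteq> Q i" if "i \<in> \<Lambda>" for i
    unfolding I using that by blast
  have "Q ` \<Lambda> = minimal_primes R I"
  proof (intro equalityI subsetI)
    fix P assume "P \<in> Q ` \<Lambda>"
    then obtain i where i: "i \<in> \<Lambda>" "P = Q i" by blast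
    have "P' = P" if P': "primeideal P' R" "I \<subseteq> P'" "P' \<subseteq> P" for P'
    proof -
      obtain l where l: "l \<in> \<Lambda>" "Q l \<subseteq> P'" using above P' by blast
      then have "l = i" using anti i P'(3) by blast
      then show ?thesis using l i P'(3) by blast
    qed
    then show "P \<in> minimal_primes R I"
      using i prime I_le by (auto simp: minimal_primes_def)
  next
    fix P assume P: "P \<in> minimal_primes R I"
    then obtain l where l: "l \<in> \<Lambda>" "Q l \<subseteq> P"
      using above[of P] unfolding minimal_primes_def by blast
    then have "Q l = P"
      using P prime[of l] I_le[of l] unfolding minimal_primes_def by blast
    with l show "P \<in> Q ` \<Lambda>" by blast
  qed
  with inj show "bij_betw Q \<Lambda> (minimal_primes R I)"
    by (simp add: bij_betw_def)
qed


section \<open>Monomial ideals\<close>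

lemma keys_add_nat:
  fixes u w :: "'a \<Rightarrow>\<^sub>0 nat"
  shows "Poly_Mapping.keys (u + w) = Poly_Mapping.keys u \<union> Poly_Mapping.keys w"
  by (auto simp: in_keys_iff lookup_add)

lemma mpoly_ring_ops:
  "x \<oplus>\<^bsub>mpoly_ring n\<^esub> y = x + y" "x \<otimes>\<^bsub>mpoly_ring n\<^esub> y = x * y"
  "\<zero>\<^bsub>mpoly_ring n\<^esub> = 0" "\<one>\<^bsub>mpoly_ring n\<^esub> = 1"
  by (simp_all add: mpoly_ring_def)

lemma mpoly_ring_carrier:
  "p \<in> carrier (mpoly_ring n) \<longleftrightarrow> (\<forall>m\<in>Poly_Mapping.keys p. Poly_Mapping.keys m \<subseteq> {1..n})"
  by (simp add: mpoly_ring_def)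

definition terms_in :: "'a set \<Rightarrow> ('a \<Rightarrow>\<^sub>0 'b) \<Rightarrow> 'a \<Rightarrow>\<^sub>0 'b::comm_monoid_add" where
  "terms_in X p = (\<Sum>m\<in>Poly_Mapping.keys p \<inter> X. Poly_Mapping.single m (Poly_Mapping.lookup p m))"

lemma lookup_terms_in:
  "Poly_Mapping.lookup (terms_in X p) m = (if m \<in> X then Poly_Mapping.lookup p m else 0)"
  by (auto simp: terms_in_def lookup_sum lookup_single when_def in_keys_iff sum.delta)

lemma keys_terms_in: "Poly_Mapping.keys (terms_in X p) = Poly_Mapping.keys p \<inter> X"
  by (auto simp: in_keys_iff lookup_terms_in split: if_splits)

lemma sum_of_terms:
  "(\<Sum>m\<in>Poly_Mapping.keys p. Poly_Mapping.single m (Poly_Mapping.lookup p m)) = p"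
  using lookup_terms_in[of UNIV p] by (intro poly_mapping_eqI) (simp add: terms_in_def)

lemma ideal_sum_closed:
  assumes "ideal J (mpoly_ring n)" "\<And>x. x \<in> X \<Longrightarrow> f x \<in> J"
  shows "sum f X \<in> J"
proof -
  interpret ideal J "mpoly_ring n" by (fact assms(1))
  show ?thesis
    using assms(2)
  proof (induction X rule: infinite_finite_induct)
    case (insert x X)
    then show ?case using additive_subgroup.a_closed[OF additive_subgroup_axioms, of "f x" "sum f X"] by (simp add: mpoly_ring_ops)
  qed (use additive_subgroup.zero_closed[OF additive_subgroup_axioms] in \<open>simp_all add: mpoly_ring_ops\<close>)
qed

text \<open>
  Divisibility is written as existence of a cofactor exponent \<open>w\<close>, so that multiplying a term, that
  is, adding an exponent, visibly preserves it.
\<close>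

lemma ideal_of_divisible_terms:
  "ideal {p \<in> carrier (mpoly_ring n :: 'k::comm_ring_1 mpoly ring).
      \<forall>m\<in>Poly_Mapping.keys p. \<exists>u\<in>M. \<exists>w. m = u + w} (mpoly_ring n)"
    (is "ideal ?J ?R")
proof -
  interpret cring ?R by (rule cring_mpoly_ring)
  have div: "\<exists>u\<in>M. \<exists>w. a + b = u + w" if "\<exists>u\<in>M. \<exists>w. a = u + w" for a b
    using that by (metis add.assoc)
  have mult: "x * p \<in> ?J" if p: "p \<in> ?J" and x: "x \<in> carrier ?R" for p x
  proof -
    have "x * p \<in> carrier ?R" using m_closed[of x p] that by (simp add: mpoly_ring_ops)
    moreover have "\<exists>u\<in>M. \<exists>w. m = u + w" if m: "m \<in> Poly_Mapping.keys (x * p)" for m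
    proof -
      obtain a b where ab: "m = a + b" and "b \<in> Poly_Mapping.keys p"
        using m keys_mult[of x p] by blast
      then show ?thesis using p div[of b a] unfolding ab add.commute[of a b] by blast
    qed
    ultimately show ?thesis by blast
  qed
  have add: "p + r \<in> ?J" if "p \<in> ?J" "r \<in> ?J" for p r
    using that a_closed[of p r] Poly_Mapping.keys_add[of p r] by (auto simp: mpoly_ring_ops)
  have "subgroup ?J (add_monoid ?R)"
  proof (rule add.subgroupI)
    have "0 \<in> ?J" using zero_closed by (simp add: mpoly_ring_ops)
    then show "?J \<noteq> {}" by blast
    fix p assume p: "p \<in> ?J"
    have "\<ominus>\<^bsub>?R\<^esub> p = \<ominus>\<^bsub>?R\<^esub> \<one>\<^bsub>?R\<^esub> \<otimes>\<^bsub>?R\<^esub> p" using p by (simp add: l_minus)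
    also have "\<dots> \<in> ?J" using mult[OF p, of "\<ominus>\<^bsub>?R\<^esub> \<one>\<^bsub>?R\<^esub>"] by (simp add: mpoly_ring_ops(2))
    finally show "\<ominus>\<^bsub>?R\<^esub> p \<in> ?J" .
  next
    fix p r assume "p \<in> ?J" "r \<in> ?J"
    then show "p \<oplus>\<^bsub>?R\<^esub> r \<in> ?J" unfolding mpoly_ring_ops(1) by (rule add)
  qed blast
  then show ?thesis
    using mult by (intro idealI ring_axioms) (simp_all add: mpoly_ring_ops mult.commute)
qed

text \<open>
  The polynomials all of whose terms are divisible by a generator form an ideal containing the
  generators. Conversely such a polynomial is the sum of its terms, each of them a multiple of a
  generator.
\<close>

lemma monomial_ideal_mem_iff:
  fixes p :: "'k::comm_ring_1 mpoly"
  assumes M: "\<And>u. u \<in> M \<Longrightarrow> Poly_Mapping.keys u \<subseteq> {1..n}"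
  shows "p \<in> Idl\<^bsub>mpoly_ring n\<^esub> (monomial ` M) \<longleftrightarrow>
    p \<in> carrier (mpoly_ring n) \<and> (\<forall>m\<in>Poly_Mapping.keys p. \<exists>u\<in>M. \<exists>w. m = u + w)"
proof -
  let ?R = "mpoly_ring n :: 'k mpoly ring"
  interpret cring ?R by (rule cring_mpoly_ring)
  have gens: "monomial ` M \<subseteq> carrier ?R"
    using M by (auto simp: mpoly_ring_carrier monomial_def)
  interpret J: ideal "Idl\<^bsub>?R\<^esub> (monomial ` M)" ?R by (rule genideal_ideal[OF gens])
  show ?thesis
  proof
    assume "p \<in> Idl\<^bsub>?R\<^esub> (monomial ` M)"
    moreover have "monomial ` M \<subseteq> {p \<in> carrier ?R. \<forall>m\<in>Poly_Mapping.keys p. \<exists>u\<in>M. \<exists>w. m = u + w}"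
    proof (intro subsetI CollectI conjI ballI)
      fix p m assume "p \<in> monomial ` M" and m: "m \<in> Poly_Mapping.keys p"
      then obtain u where "u \<in> M" "m = u + 0" by (auto simp: monomial_def split: if_splits)
      then show "\<exists>u\<in>M. \<exists>w. m = u + w" by blast
    qed (use gens in blast)
    ultimately show "p \<in> carrier ?R \<and> (\<forall>m\<in>Poly_Mapping.keys p. \<exists>u\<in>M. \<exists>w. m = u + w)"
      using genideal_minimal[OF ideal_of_divisible_terms] by blast
  next
    assume p: "p \<in> carrier ?R \<and> (\<forall>m\<in>Poly_Mapping.keys p. \<exists>u\<in>M. \<exists>w. m = u + w)"
    have "(\<Sum>m\<in>Poly_Mapping.keys p. Poly_Mapping.single m (Poly_Mapping.lookup p m))
        \<in> Idl\<^bsub>?R\<^esub> (monomial ` M)"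
    proof (rule ideal_sum_closed[OF J.is_ideal])
      fix m assume m: "m \<in> Poly_Mapping.keys p"
      then obtain u w where u: "u \<in> M" and w: "m = u + w" using p by blast
      let ?c = "Poly_Mapping.single w (Poly_Mapping.lookup p m) :: 'k mpoly"
      have "Poly_Mapping.keys (u + w) \<subseteq> {1..n}"
        using p m unfolding w mpoly_ring_carrier by blast
      then have "Poly_Mapping.keys w \<subseteq> {1..n}" by (simp add: keys_add_nat)
      then have "?c \<in> carrier ?R" by (simp add: mpoly_ring_carrier)
      then have "monomial u \<otimes>\<^bsub>?R\<^esub> ?c \<in> Idl\<^bsub>?R\<^esub> (monomial ` M)"
        using genideal_self[OF gens] u by (intro J.I_r_closed) auto
      then show "Poly_Mapping.single m (Poly_Mapping.lookup p m) \<in> Idl\<^bsub>?R\<^esub> (monomial ` M)"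
        by (simp add: mpoly_ring_ops monomial_def mult_single w)
    qed
    then show "p \<in> Idl\<^bsub>?R\<^esub> (monomial ` M)" by (simp add: sum_of_terms)
  qed
qed

lemma ideal_var_ideal:
  assumes "G \<subseteq> {1..n}"
  shows "ideal (var_ideal n G :: 'k::comm_ring_1 mpoly set) (mpoly_ring n)"
  unfolding var_ideal_def using assms
  by (intro ring.genideal_ideal cring.axioms(1) cring_mpoly_ring)
    (auto simp: mpoly_ring_carrier var_def monomial_def)

lemma single_dvd_iff:
  fixes m :: "'a \<Rightarrow>\<^sub>0 nat"
  shows "(\<exists>w. m = Poly_Mapping.single i 1 + w) \<longleftrightarrow> i \<in> Poly_Mapping.keys m"
proof
  assume "i \<in> Poly_Mapping.keys m"
  then have "m = Poly_Mapping.single i 1 + (m - Poly_Mapping.single i 1)"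
    by (intro poly_mapping_eqI)
      (auto simp: lookup_add lookup_minus lookup_single when_def in_keys_iff)
  then show "\<exists>w. m = Poly_Mapping.single i 1 + w" ..
qed (auto simp: keys_add_nat)

lemma var_ideal_mem_iff:
  fixes p :: "'k::comm_ring_1 mpoly"
  assumes "G \<subseteq> {1..n}"
  shows "p \<in> var_ideal n G \<longleftrightarrow>
    p \<in> carrier (mpoly_ring n) \<and> (\<forall>m\<in>Poly_Mapping.keys p. Poly_Mapping.keys m \<inter> G \<noteq> {})"
proof -
  have "var ` G = (monomial ` (\<lambda>i. Poly_Mapping.single i 1) ` G :: 'k mpoly set)"
    by (auto simp: var_def image_image)
  moreover have "(\<exists>u\<in>(\<lambda>i. Poly_Mapping.single i 1) ` G. \<exists>w. m = u + w) \<longleftrightarrow>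
      Poly_Mapping.keys m \<inter> G \<noteq> {}" for m :: "nat \<Rightarrow>\<^sub>0 nat"
    using single_dvd_iff[of m] by auto
  ultimately show ?thesis
    using assms unfolding var_ideal_def
    by (subst \<open>var ` G = _\<close>, subst monomial_ideal_mem_iff) auto
qed

text \<open>
  The terms free of \<open>G\<close> represent a polynomial modulo \<open>P\<^sub>G\<close>. If \<open>a\<close> and \<open>b\<close> are outside \<open>P\<^sub>G\<close>, their
  \<open>G\<close>-free parts are nonzero, and so is the product of these parts since polynomials form a domain.
  The remaining summands of \<open>a b\<close> have only terms that meet \<open>G\<close>, so nothing cancels a monomial of
  that product, and \<open>a b\<close> is outside \<open>P\<^sub>G\<close>.
\<close>

lemma primeideal_var_ideal:
  assumes G: "G \<subseteq> {1..n}"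
  shows "primeideal (var_ideal n G :: 'k::idom mpoly set) (mpoly_ring n)"
proof (rule primeidealI)
  show "cring (mpoly_ring n :: 'k mpoly ring)" by (rule cring_mpoly_ring)
  show "ideal (var_ideal n G :: 'k mpoly set) (mpoly_ring n)" by (rule ideal_var_ideal[OF G])
  have "(1 :: 'k mpoly) \<notin> var_ideal n G"
    by (simp add: var_ideal_mem_iff[OF G])
  moreover have "(1 :: 'k mpoly) \<in> carrier (mpoly_ring n)"
    by (simp add: mpoly_ring_carrier)
  ultimately show "carrier (mpoly_ring n) \<noteq> (var_ideal n G :: 'k mpoly set)" by metis
  fix a b :: "'k mpoly"
  assume carr: "a \<in> carrier (mpoly_ring n)" "b \<in> carrier (mpoly_ring n)"
    and ab: "a \<otimes>\<^bsub>mpoly_ring n\<^esub> b \<in> var_ideal n G"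
  define D where "D = {m :: nat \<Rightarrow>\<^sub>0 nat. Poly_Mapping.keys m \<inter> G = {}}"
  show "a \<in> var_ideal n G \<or> b \<in> var_ideal n G"
  proof (rule ccontr)
    assume "\<not> ?thesis"
    then have "terms_in D a \<noteq> 0" "terms_in D b \<noteq> 0"
      using carr keys_terms_in[of D a] keys_terms_in[of D b]
      by (auto simp: var_ideal_mem_iff[OF G] D_def)
    then have "terms_in D a * terms_in D b \<noteq> 0" by simp
    then obtain m where m: "m \<in> Poly_Mapping.keys (terms_in D a * terms_in D b)"
      by (metis keys_eq_empty ex_in_conv)
    then obtain x y where "m = x + y" "x \<in> D" "y \<in> D"
      using keys_mult[of "terms_in D a" "terms_in D b"] by (auto simp: keys_terms_in)
    then have "m \<in> D" by (simp add: D_def keys_add_nat Int_Un_distrib2)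
    have split: "p = terms_in D p + terms_in (- D) p" for p :: "'k mpoly"
      by (intro poly_mapping_eqI) (simp add: lookup_add lookup_terms_in)
    have "a * b = (terms_in D a + terms_in (- D) a) * (terms_in D b + terms_in (- D) b)"
      using split by metis
    then have "a * b = terms_in D a * terms_in D b + (terms_in D a * terms_in (- D) b
        + terms_in (- D) a * terms_in D b + terms_in (- D) a * terms_in (- D) b)"
      by (simp add: algebra_simps)
    moreover have "m \<notin> Poly_Mapping.keys (x * y)"
      if "Poly_Mapping.keys x \<subseteq> - D \<or> Poly_Mapping.keys y \<subseteq> - D" for x y :: "'k mpoly"
      using keys_mult[of x y] that \<open>m \<in> D\<close> by (fastforce simp: D_def keys_add_nat)
    ultimately have "m \<in> Poly_Mapping.keys (a * b)"
      using m by (simp add: in_keys_iff lookup_add keys_terms_in)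
    then show False
      using ab \<open>m \<in> D\<close> by (auto simp: mpoly_ring_ops var_ideal_mem_iff[OF G] D_def)
  qed
qed

lemma var_ideal_subset_iff:
  assumes "G \<subseteq> {1..n}" "G' \<subseteq> {1..n}"
  shows "(var_ideal n G :: 'k::comm_ring_1 mpoly set) \<subseteq> var_ideal n G' \<longleftrightarrow> G \<subseteq> G'"
proof
  assume sub: "(var_ideal n G :: 'k mpoly set) \<subseteq> var_ideal n G'"
  show "G \<subseteq> G'"
  proof
    fix i assume "i \<in> G"
    then have "(var i :: 'k mpoly) \<in> var_ideal n G"
      using assms by (auto simp: var_ideal_mem_iff mpoly_ring_carrier var_def monomial_def)
    then have "(var i :: 'k mpoly) \<in> var_ideal n G'" using sub by blast
    then show "i \<in> G'"
      using assms by (auto simp: var_ideal_mem_iff var_def monomial_def)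
  qed
next
  assume "G \<subseteq> G'"
  then have "S \<inter> G' \<noteq> {}" if "S \<inter> G \<noteq> {}" for S using that by blast
  then show "(var_ideal n G :: 'k mpoly set) \<subseteq> var_ideal n G'"
    unfolding subset_iff var_ideal_mem_iff[OF assms(1)] var_ideal_mem_iff[OF assms(2)] by metis
qed


section \<open>Squarefree monomials as sets of indices\<close>

definition sqfree :: "nat set \<Rightarrow> nat \<Rightarrow>\<^sub>0 nat" where
  "sqfree S = (\<Sum>i\<in>S. Poly_Mapping.single i 1)"

lemma lookup_sqfree:
  "finite S \<Longrightarrow> Poly_Mapping.lookup (sqfree S) i = (if i \<in> S then 1 else 0)"
  by (simp add: sqfree_def lookup_sum lookup_single when_def)

lemma keys_sqfree: "finite S \<Longrightarrow> Poly_Mapping.keys (sqfree S) = S"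
  by (auto simp: in_keys_iff lookup_sqfree split: if_splits)

lemma squarefree_monomials_eq:
  "squarefree_monomials n q = sqfree ` {W. W \<subseteq> {1..n} \<and> card W = q}"
proof (intro equalityI subsetI)
  fix m assume m: "m \<in> squarefree_monomials n q"
  have le: "Poly_Mapping.lookup m i \<le> 1" for i
    using m by (auto simp: squarefree_monomials_def)
  have one: "Poly_Mapping.lookup m i = (if i \<in> Poly_Mapping.keys m then 1 else 0)" for i
    using le[of i] by (auto simp: in_keys_iff)
  then have "m = sqfree (Poly_Mapping.keys m)"
    by (intro poly_mapping_eqI) (simp add: lookup_sqfree)
  moreover have "card (Poly_Mapping.keys m) = q"
    using m one by (simp add: squarefree_monomials_def)
  ultimately show "m \<in> sqfree ` {W. W \<subseteq> {1..n} \<and> card W = q}"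
    using m by (auto simp: squarefree_monomials_def)
next
  fix m assume "m \<in> sqfree ` {W. W \<subseteq> {1..n} \<and> card W = q}"
  then obtain W where W: "W \<subseteq> {1..n}" "card W = q" "m = sqfree W" by blast
  then have "finite W" using finite_subset by blast
  then show "m \<in> squarefree_monomials n q"
    using W by (auto simp: squarefree_monomials_def keys_sqfree lookup_sqfree)
qed

lemma sqfree_less_iff:
  assumes "finite V" "finite W"
  shows "sqfree V < sqfree W \<longleftrightarrow> (\<exists>i\<in>W - V. \<forall>l<i. l \<in> V \<longleftrightarrow> l \<in> W)"
  using assms by (auto simp: less_monomial_iff lookup_sqfree split: if_splits)

lemma sqfree_dvd_iff:
  assumes "finite W"
  shows "(\<exists>w. m = sqfree W + w) \<longleftrightarrow> W \<subseteq> Poly_Mapping.keys m"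
proof
  assume "W \<subseteq> Poly_Mapping.keys m"
  then have "m = sqfree W + (m - sqfree W)"
    using assms by (intro poly_mapping_eqI)
      (auto simp: lookup_add lookup_minus lookup_sqfree in_keys_iff subset_iff)
  then show "\<exists>w. m = sqfree W + w" ..
qed (use assms in \<open>auto simp: keys_add_nat keys_sqfree\<close>)


section \<open>Vertex covers of an initial lexsegment\<close>

locale lexsegment =
  fixes n q :: nat and j :: "nat \<Rightarrow> nat"
  assumes q_pos: "q \<ge> 1" and j_pos: "j 1 \<ge> 1" and j_mono: "strict_mono_on {1..q} j"
    and j_le: "j q \<le> n"
begin

definition V :: "nat set" where "V = j ` {1..q}"

definition A :: "nat \<Rightarrow> nat set" where "A t = {1..j t} - j ` {1..<t}"

definition \<F> :: "nat set set" where
  "\<F> = {F. F \<subseteq> {1..n} \<and> card F = q - 1 \<and> (\<forall>t\<in>{1..q}. F \<inter> A t \<noteq> {})}"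

lemma j_less_iff: "s \<in> {1..q} \<Longrightarrow> t \<in> {1..q} \<Longrightarrow> j s < j t \<longleftrightarrow> s < t"
  using j_mono by (meson strict_mono_on_less)

lemma j_inj: "inj_on j {1..q}"
  using j_mono by (rule strict_mono_on_imp_inj_on)

lemma j_bounds:
  assumes "t \<in> {1..q}"
  shows "1 \<le> j t" "j t \<le> n"
proof -
  show "1 \<le> j t" using assms j_pos q_pos j_less_iff[of 1 t] by (cases "t = 1") auto
  show "j t \<le> n" using assms j_le q_pos j_less_iff[of t q] by (cases "t = q") auto
qed

lemma V_subset: "V \<subseteq> {1..n}"
  using j_bounds by (auto simp: V_def)

lemma finite_V: "finite V"
  by (simp add: V_def)

lemma card_V: "card V = q"
  unfolding V_def by (subst card_image[OF j_inj]) simp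

lemma A_subset: "t \<in> {1..q} \<Longrightarrow> A t \<subseteq> {1..n}"
  using j_bounds[of t] by (auto simp: A_def)

lemma j_mem_A_iff:
  assumes s: "s \<in> {1..q}" and t: "t \<in> {1..q}"
  shows "j s \<in> A t \<longleftrightarrow> s = t"
proof -
  have "j s \<le> j t \<longleftrightarrow> s \<le> t" using j_less_iff[OF t s] by auto
  moreover have "j s \<in> j ` {1..<t} \<longleftrightarrow> s < t"
    using inj_on_image_mem_iff[OF j_inj s, of "{1..<t}"] s t by (simp add: subset_iff)
  ultimately show ?thesis using j_bounds(1)[OF s] by (auto simp: A_def)
qed

lemma finite_\<F>: "finite \<F>"
  by (rule finite_subset[of _ "Pow {1..n}"]) (auto simp: \<F>_def)

text \<open>
  At the first index \<open>i\<close> where \<open>W\<close> and \<open>V\<close> differ, \<open>i \<in> W - V\<close>. If \<open>i < j\<^sub>t\<close>, then \<open>i\<close> itself lies in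
  \<open>A\<^sub>t\<close>; otherwise \<open>W\<close> still agrees with \<open>V\<close> at \<open>j\<^sub>t \<in> A\<^sub>t\<close>.
\<close>

lemma lex_ge_meets_A:
  assumes W: "W \<subseteq> {1..n}" and ge: "sqfree V \<le> sqfree W" and t: "t \<in> {1..q}"
  shows "W \<inter> A t \<noteq> {}"
proof (cases "sqfree V = sqfree W")
  case True
  then have "V = W"
    using keys_sqfree finite_V finite_subset[OF W] by (metis finite_atLeastAtMost)
  moreover have "j t \<in> V \<inter> A t" using j_mem_A_iff[OF t t] t by (simp add: V_def)
  ultimately show ?thesis by blast
next
  case False
  then obtain i where i: "i \<in> W" "i \<notin> V" and below: "\<And>l. l < i \<Longrightarrow> l \<in> V \<longleftrightarrow> l \<in> W"
    using ge sqfree_less_iff[OF finite_V finite_subset[OF W]] by (auto simp: less_le)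
  have "j t \<in> V" using t by (auto simp: V_def)
  consider "i < j t" | "j t < i" using i \<open>j t \<in> V\<close> by (cases i "j t" rule: linorder_cases) auto
  then show ?thesis
  proof cases
    case 1
    then have "i \<in> A t" using i W t by (auto simp: A_def V_def)
    then show ?thesis using i by blast
  next
    case 2
    then have "j t \<in> W" using below \<open>j t \<in> V\<close> by blast
    then show ?thesis using j_mem_A_iff t by blast
  qed
qed

text \<open>
  For \<open>V\<close> not contained in \<open>H\<close>, let \<open>j\<^sub>s\<close> be its first element outside \<open>H\<close> and \<open>f \<in> H \<inter> A\<^sub>s\<close>. Every
  \<open>W\<close> containing \<open>j\<^sub>1, \<dots>, j\<^sub>s\<^sub>-\<^sub>1\<close> and \<open>f\<close> exceeds \<open>V\<close>: up to \<open>f < j\<^sub>s\<close> it loses nothing of \<open>V\<close>, and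
  it gains at least \<open>f\<close>. These at most \<open>s \<le> q\<close> elements extend to a \<open>q\<close>-subset of \<open>H\<close>.
\<close>

lemma exists_lex_ge_subset:
  assumes H: "H \<subseteq> {1..n}" and card: "q \<le> card H"
    and meets: "\<And>t. t \<in> {1..q} \<Longrightarrow> H \<inter> A t \<noteq> {}"
  shows "\<exists>W\<subseteq>H. card W = q \<and> sqfree V \<le> sqfree W"
proof (cases "V \<subseteq> H")
  case True
  then show ?thesis using card_V by blast
next
  case False
  define s where "s = (LEAST t. t \<in> {1..q} \<and> j t \<notin> H)"
  have "\<exists>t. t \<in> {1..q} \<and> j t \<notin> H" using False by (auto simp: V_def)
  then have s: "s \<in> {1..q}" "j s \<notin> H"
    unfolding s_def by (metis (mono_tags, lifting) LeastI)+
  have before_s: "j t \<in> H" if "t \<in> {1..<s}" for t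
    using that s not_less_Least[of t "\<lambda>t. t \<in> {1..q} \<and> j t \<notin> H"] by (auto simp: s_def)
  obtain f where f: "f \<in> H" "f \<in> A s" using meets[OF s(1)] by blast
  have f_less: "f < j s" using f s by (auto simp: A_def order.strict_iff_order)
  have "f \<notin> V"
    using f j_mem_A_iff s by (auto simp: V_def)
  have "finite H" using H finite_subset by blast
  have "card (insert f (j ` {1..<s})) \<le> Suc (card (j ` {1..<s}))"
    by (simp add: card_insert_if)
  also have "\<dots> \<le> Suc (card {1..<s})"
    using card_image_le[of "{1..<s}" j] by simp
  finally have "card (insert f (j ` {1..<s})) \<le> q" using s by simp
  moreover have "insert f (j ` {1..<s}) \<subseteq> H" using f before_s by blast
  ultimately obtain W where W: "insert f (j ` {1..<s}) \<subseteq> W" "W \<subseteq> H" "card W = q"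
    using exists_subset_between[OF _ card _ \<open>finite H\<close>] by blast
  \<comment> \<open>The first difference need not be \<open>f\<close>: enlarging to \<open>W\<close> may have added smaller elements.\<close>
  define i where "i = (LEAST l. l \<in> W - V)"
  have "f \<in> W - V" using W(1) \<open>f \<notin> V\<close> by simp
  then have i: "i \<in> W - V" and "i \<le> f"
    unfolding i_def by (rule LeastI, rule Least_le)
  have "l \<in> V \<longleftrightarrow> l \<in> W" if "l < i" for l
  proof
    assume "l \<in> V"
    then obtain u where u: "u \<in> {1..q}" "l = j u" by (auto simp: V_def)
    then have "u < s" using that \<open>i \<le> f\<close> f_less j_less_iff s by force
    then show "l \<in> W" using u W(1) by auto
  next
    assume "l \<in> W"
    then show "l \<in> V" using that not_less_Least[of l "\<lambda>l. l \<in> W - V"] by (auto simp: i_def)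
  qed
  then have "sqfree V < sqfree W"
    using i sqfree_less_iff[OF finite_V finite_subset[OF W(2) \<open>finite H\<close>]] by blast
  then show ?thesis using W by auto
qed

lemma contains_lex_ge_iff:
  assumes H: "H \<subseteq> {1..n}"
  shows "(\<exists>W\<subseteq>H. card W = q \<and> sqfree V \<le> sqfree W) \<longleftrightarrow>
    (\<forall>t\<in>{1..q}. H \<inter> A t \<noteq> {}) \<and> (\<forall>F\<in>\<F>. H \<inter> ({1..n} - F) \<noteq> {})"
proof (intro iffI conjI ballI)
  assume "\<exists>W\<subseteq>H. card W = q \<and> sqfree V \<le> sqfree W"
  then obtain W where W: "W \<subseteq> H" "card W = q" "sqfree V \<le> sqfree W" by blast
  show "H \<inter> A t \<noteq> {}" if "t \<in> {1..q}" for t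
    using lex_ge_meets_A[OF _ W(3) that] W(1) H by blast
  show "H \<inter> ({1..n} - F) \<noteq> {}" if F: "F \<in> \<F>" for F
  proof
    assume "H \<inter> ({1..n} - F) = {}"
    then have "W \<subseteq> F" using W(1) H by blast
    moreover have "finite F" using F finite_subset[of F "{1..n}"] by (simp add: \<F>_def)
    ultimately have "q \<le> q - 1" using W(2) F card_mono[of F W] by (simp add: \<F>_def)
    then show False using q_pos by simp
  qed
next
  assume "(\<forall>t\<in>{1..q}. H \<inter> A t \<noteq> {}) \<and> (\<forall>F\<in>\<F>. H \<inter> ({1..n} - F) \<noteq> {})"
  then have HA: "\<And>t. t \<in> {1..q} \<Longrightarrow> H \<inter> A t \<noteq> {}"
    and HF: "\<And>F. F \<in> \<F> \<Longrightarrow> H \<inter> ({1..n} - F) \<noteq> {}" by blast+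
  \<comment> \<open>A support with fewer than \<open>q\<close> elements would lie in some \<open>F \<in> \<F>\<close> and miss its complement.\<close>
  have "q \<le> card H"
  proof (rule ccontr)
    assume "\<not> q \<le> card H"
    moreover have "q \<le> n" using card_mono[OF _ V_subset] card_V by simp
    ultimately have "card H \<le> q - 1" "q - 1 \<le> card {1..n}" by simp_all
    then obtain F where F: "H \<subseteq> F" "F \<subseteq> {1..n}" "card F = q - 1"
      using exists_subset_between[of H "q - 1" "{1..n}"] H by blast
    then have "F \<in> \<F>" using HA by (fastforce simp: \<F>_def)
    then show False using HF F by blast
  qed
  then show "\<exists>W\<subseteq>H. card W = q \<and> sqfree V \<le> sqfree W"
    using exists_lex_ge_subset[OF H _ HA] by blast
qed

text \<open>
  The variables generating each component; the disjoint sum keeps the two families of components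
  apart, so that a coincidence between them would count as a repetition.
\<close>

definition cover :: "nat + nat set \<Rightarrow> nat set" where
  "cover = case_sum A (\<lambda>F. {1..n} - F)"

lemma cover_subset: "c \<in> {1..q} <+> \<F> \<Longrightarrow> cover c \<subseteq> {1..n}"
  by (elim PlusE) (use A_subset in \<open>simp_all add: cover_def\<close>)

text \<open>
  All of \<open>V\<close> except \<open>j\<^sub>t\<close> lies outside \<open>A\<^sub>t\<close>, hence would lie in \<open>F\<close>. These are \<open>q - 1 = |F|\<close>
  elements, so \<open>F\<close> would consist of them alone and miss \<open>A\<^sub>t\<close>.
\<close>

lemma compl_not_subset_A:
  assumes F: "F \<in> \<F>" and t: "t \<in> {1..q}"
  shows "\<not> {1..n} - F \<subseteq> A t"
proof
  assume sub: "{1..n} - F \<subseteq> A t"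
  have "(V - {j t}) \<inter> A t = {}" using j_mem_A_iff t unfolding V_def by blast
  then have "V - {j t} \<subseteq> F" using sub V_subset by blast
  moreover have "finite F" using F finite_subset[of F "{1..n}"] by (simp add: \<F>_def)
  moreover have "card (V - {j t}) = card F"
    using F t card_V finite_V by (simp add: \<F>_def V_def)
  ultimately have "F = V - {j t}" by (metis card_subset_eq)
  then have "F \<inter> A t = {}" using \<open>(V - {j t}) \<inter> A t = {}\<close> by simp
  then show False using F t by (auto simp: \<F>_def)
qed

text \<open>
  Among the \<open>A\<^sub>t\<close>, the element \<open>j\<^sub>s\<close> lies in \<open>A\<^sub>s\<close> only. No \<open>A\<^sub>t\<close> is inside \<open>F\<^sup>c\<close> because \<open>F\<close> meets
  \<open>A\<^sub>t\<close>, and the sets \<open>F\<^sup>c\<close> all have the same size.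
\<close>

lemma cover_antichain:
  assumes "c \<in> {1..q} <+> \<F>" "d \<in> {1..q} <+> \<F>" and sub: "cover c \<subseteq> cover d"
  shows "c = d"
  using assms(1)
proof
  fix s assume c: "c = Inl s" and s: "s \<in> {1..q}"
  show ?thesis using assms(2)
  proof
    fix t assume "d = Inl t" "t \<in> {1..q}"
    moreover have "j s \<in> A s" using j_mem_A_iff s by blast
    ultimately show ?thesis using sub c s j_mem_A_iff by (auto simp: cover_def)
  next
    fix F assume "d = Inr F" "F \<in> \<F>"
    then show ?thesis using sub c s by (fastforce simp: cover_def \<F>_def)
  qed
next
  fix F assume c: "c = Inr F" and F: "F \<in> \<F>"
  show ?thesis using assms(2)
  proof
    fix t assume "d = Inl t" "t \<in> {1..q}"
    then show ?thesis using sub c compl_not_subset_A F by (auto simp: cover_def)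
  next
    fix F' assume d: "d = Inr F'" "F' \<in> \<F>"
    then have "F' \<subseteq> F" using sub c by (auto simp: cover_def \<F>_def)
    moreover have "finite F" using F finite_subset[of F "{1..n}"] by (simp add: \<F>_def)
    ultimately have "F' = F" using F d by (intro card_subset_eq) (auto simp: \<F>_def)
    then show ?thesis using c d by simp
  qed
qed

lemma lexsegment_ideal_mem_iff:
  fixes p :: "'k::comm_ring_1 mpoly"
  shows "p \<in> initial_lexsegment_ideal n q (sqfree V) \<longleftrightarrow> p \<in> carrier (mpoly_ring n) \<and>
    (\<forall>m\<in>Poly_Mapping.keys p. \<exists>W\<subseteq>Poly_Mapping.keys m. card W = q \<and> sqfree V \<le> sqfree W)"
proof -
  let ?L = "initial_lexsegment n q (sqfree V)"
  have L: "?L = sqfree ` {W. W \<subseteq> {1..n} \<and> card W = q \<and> sqfree V \<le> sqfree W}"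
    by (auto simp: initial_lexsegment_def squarefree_monomials_eq)
  have "Poly_Mapping.keys u \<subseteq> {1..n}" if "u \<in> ?L" for u
    using that by (auto simp: initial_lexsegment_def squarefree_monomials_def)
  then have "p \<in> initial_lexsegment_ideal n q (sqfree V) \<longleftrightarrow> p \<in> carrier (mpoly_ring n) \<and>
      (\<forall>m\<in>Poly_Mapping.keys p. \<exists>u\<in>?L. \<exists>w. m = u + w)"
    unfolding initial_lexsegment_ideal_def by (rule monomial_ideal_mem_iff)
  moreover have "(\<exists>u\<in>?L. \<exists>w. m = u + w) \<longleftrightarrow>
      (\<exists>W\<subseteq>Poly_Mapping.keys m. card W = q \<and> sqfree V \<le> sqfree W)"
    if m: "Poly_Mapping.keys m \<subseteq> {1..n}" for m
  proof -
    have "(\<exists>w. m = sqfree W + w) \<longleftrightarrow> W \<subseteq> Poly_Mapping.keys m" if "W \<subseteq> {1..n}" for W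
      using sqfree_dvd_iff[of W m] finite_subset[OF that] by simp
    then have "(\<exists>u\<in>?L. \<exists>w. m = u + w) \<longleftrightarrow> (\<exists>W\<in>{W. W \<subseteq> {1..n} \<and> card W = q \<and> sqfree V \<le> sqfree W}.
        W \<subseteq> Poly_Mapping.keys m)"
      unfolding L bex_simps(7) by (intro bex_cong refl) simp
    also have "\<dots> \<longleftrightarrow> (\<exists>W\<subseteq>Poly_Mapping.keys m. card W = q \<and> sqfree V \<le> sqfree W)"
      using m by (auto dest: subset_trans)
    finally show ?thesis .
  qed
  ultimately show ?thesis unfolding mpoly_ring_carrier by (simp cong: conj_cong)
qed

lemma lexsegment_ideal_eq:
  "(initial_lexsegment_ideal n q (sqfree V) :: 'k::comm_ring_1 mpoly set) =
    carrier (mpoly_ring n) \<inter> (\<Inter>c\<in>{1..q} <+> \<F>. var_ideal n (cover c))"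
proof (rule Set.set_eqI)
  fix p :: "'k mpoly"
  have covers: "(\<exists>W\<subseteq>Poly_Mapping.keys m. card W = q \<and> sqfree V \<le> sqfree W) \<longleftrightarrow>
      (\<forall>c\<in>{1..q} <+> \<F>. Poly_Mapping.keys m \<inter> cover c \<noteq> {})"
    if "Poly_Mapping.keys m \<subseteq> {1..n}" for m
    unfolding contains_lex_ge_iff[OF that] Plus_def ball_Un by (simp add: cover_def)
  have "p \<in> initial_lexsegment_ideal n q (sqfree V) \<longleftrightarrow> p \<in> carrier (mpoly_ring n) \<and>
      (\<forall>m\<in>Poly_Mapping.keys p. \<forall>c\<in>{1..q} <+> \<F>. Poly_Mapping.keys m \<inter> cover c \<noteq> {})"
    unfolding lexsegment_ideal_mem_iff
    by (intro conj_cong refl ball_cong covers) (simp add: mpoly_ring_carrier)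
  also have "\<dots> \<longleftrightarrow> p \<in> carrier (mpoly_ring n) \<and> (\<forall>c\<in>{1..q} <+> \<F>. p \<in> var_ideal n (cover c))"
    using var_ideal_mem_iff[OF cover_subset, of _ p] by blast
  finally show "p \<in> initial_lexsegment_ideal n q (sqfree V) \<longleftrightarrow>
      p \<in> carrier (mpoly_ring n) \<inter> (\<Inter>c\<in>{1..q} <+> \<F>. var_ideal n (cover c))"
    by simp
qed

end


section \<open>The minimal primary decomposition\<close>

theorem theorem1:
  fixes n q :: nat
    and j :: "nat \<Rightarrow> nat"
    and v :: "nat \<Rightarrow>\<^sub>0 nat"
    and I :: "'k::field mpoly set"
    and A :: "nat \<Rightarrow> nat set"
    and \<F> :: "nat set set"
  assumes "q \<ge> 2"
    and "2 \<le> j 1" and "strict_mono_on {1..q} j" and "j q \<le> n"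
    and "v = (\<Sum>t=1..q. Poly_Mapping.single (j t) 1)"
    and "I = initial_lexsegment_ideal n q v"
    and "\<And>t. t \<in> {1..q} \<Longrightarrow> A t = {1..j t} - j ` {1..<t}"
    and "\<F> = {F. F \<subseteq> {1..n} \<and> card F = q - 1 \<and> (\<forall>t\<in>{1..q}. F \<inter> A t \<noteq> {})}"
  shows "I = (\<Inter>t\<in>{1..q}. var_ideal n (A t)) \<inter> (\<Inter>F\<in>\<F>. var_ideal n ({1..n} - F)) \<and>
    minimal_primary_decomposition (mpoly_ring n) I ({1..q} <+> \<F>)
      (case_sum (\<lambda>t. var_ideal n (A t)) (\<lambda>F. var_ideal n ({1..n} - F))) \<and>
    bij_betw (case_sum (\<lambda>t. var_ideal n (A t)) (\<lambda>F. var_ideal n ({1..n} - F)))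
      ({1..q} <+> \<F>) (minimal_primes (mpoly_ring n) I)"
proof -
  interpret L: lexsegment n q j
    using assms(1-4) by unfold_locales auto
  let ?R = "mpoly_ring n :: 'k mpoly ring"
  let ?Q = "case_sum (\<lambda>t. var_ideal n (A t)) (\<lambda>F. var_ideal n ({1..n} - F)) :: _ \<Rightarrow> 'k mpoly set"
  have A: "A t = L.A t" if "t \<in> {1..q}" for t
    using assms(7)[OF that] by (simp add: L.A_def)
  have \<F>: "\<F> = L.\<F>"
    using A by (simp add: assms(8) L.\<F>_def)
  have v: "v = sqfree L.V"
    unfolding assms(5) sqfree_def L.V_def by (subst sum.reindex[OF L.j_inj]) simp
  have Q: "?Q c = var_ideal n (L.cover c)" if "c \<in> {1..q} <+> \<F>" for c
    using that A by (auto simp: L.cover_def)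
  have sub: "L.cover c \<subseteq> {1..n}" if "c \<in> {1..q} <+> \<F>" for c
    using that L.cover_subset by (simp add: \<F>)
  have prime: "primeideal (?Q c) ?R" if "c \<in> {1..q} <+> \<F>" for c
    unfolding Q[OF that] by (rule primeideal_var_ideal[OF sub[OF that]])
  have anti: "c = d"
    if c: "c \<in> {1..q} <+> \<F>" and d: "d \<in> {1..q} <+> \<F>" and le: "?Q c \<subseteq> ?Q d" for c d
  proof -
    have "L.cover c \<subseteq> L.cover d"
      using le unfolding Q[OF c] Q[OF d] var_ideal_subset_iff[OF sub[OF c] sub[OF d]] .
    with c d show "c = d" unfolding \<F> by (rule L.cover_antichain)
  qed
  have I: "I = carrier ?R \<inter> (\<Inter>c\<in>{1..q} <+> \<F>. ?Q c)"
  proof -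
    have "(\<Inter>c\<in>{1..q} <+> \<F>. ?Q c) = (\<Inter>c\<in>{1..q} <+> \<F>. var_ideal n (L.cover c))"
      by (rule INF_cong[OF refl Q])
    then show ?thesis
      unfolding assms(6) v L.lexsegment_ideal_eq \<F> by simp
  qed
  have "var_ideal n (A 1) \<subseteq> carrier ?R"
    using A[of 1] L.A_subset[of 1] assms(1) by (auto simp: var_ideal_mem_iff)
  \<comment> \<open>Since \<open>q \<ge> 1\<close>, the first intersection is nonempty and stays inside the carrier unaided.\<close>
  moreover have "(1::nat) \<in> {1..q}" using assms(1) by simp
  ultimately have "(\<Inter>t\<in>{1..q}. var_ideal n (A t)) \<subseteq> carrier ?R"
    by (rule INF_lower2[rotated])
  moreover have "I = carrier ?R \<inter>
      ((\<Inter>t\<in>{1..q}. var_ideal n (A t)) \<inter> (\<Inter>F\<in>\<F>. var_ideal n ({1..n} - F)))"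
    unfolding I Plus_def by (simp add: INT_Un)
  ultimately have eq: "I = (\<Inter>t\<in>{1..q}. var_ideal n (A t)) \<inter> (\<Inter>F\<in>\<F>. var_ideal n ({1..n} - F))"
    by blast
  have fin: "finite ({1..q} <+> \<F>)"
    using L.finite_\<F> by (simp add: \<F>)
  show ?thesis
    by (intro conjI eq cring.antichain_of_primes_decomposition[OF cring_mpoly_ring fin prime anti I])
qed

end
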